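(* Let $\psi\in U\Psi$ with $\operatorname{supp}\psi=(1,\infty)$. Let $Q$ be an operator (not necessarily linear or sublinear), defined on $\bigcap_{p\in(1,\infty)}L_p(X,\mu)$ and on $G(\psi)$, with values in measurable functions on $X$, such that for some constants $\lambda,\gamma\ge0$ and $C<\infty$, for all $p\in(1,\infty)$ and all $f$, $$|Q[f]|_p\le C\,|f|_p\,p^{\lambda+\gamma}(p-1)^{-\gamma}.$$ Put $\psi_{\lambda,\gamma}(p)=p^{\lambda+\gamma}\psi(p)(p-1)^{-\gamma}$. Then $Q$ is bounded from $G(\psi)$ into $G(\psi_{\lambda,\gamma})$: $$\|Q\|[G(\psi)\to G(\psi_{\lambda,\gamma})]<\infty.$$
   Context: $(X,\Sigma,\mu)$ is a measure space with non-trivial $\sigma$-finite diffuse measure ($\forall A\in\Sigma$ with $0<\mu(A)<\infty$ there is $B\subset A$ with $\mu(B)=\mu(A)/2$). $|f|_p=\left(\int_X|f|^p\,d\mu\right)^{1/p}$. For $1\le a<b\le\infty$, $U\Psi(a,b)$ is the set of positive continuous functions on $(a,b)$; as a standing assumption, $\psi(a+0)=\infty$ or $\psi(b-0)=\infty$; here $(a,b)=(1,\infty)$. $\operatorname{supp}\psi=\{p:\psi(p)<\infty\}$. $G(\psi)$ is the space of all measurable $f$ with finite norm $\|f\|G(\psi)=\sup_{p\in(a,b)}|f|_p/\psi(p)$. An operator $Q$ is bounded from a Banach space $E_1$ into a Banach space $E_2$, written $\|Q\|[E_1\to E_2]<\infty$, if there is $C<\infty$ with $\|Q[f]\|_{E_2}\le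 C\|f\|_{E_1}$ for all $f\in E_1$. *)

theory Defs
  imports "HOL-Analysis.Analysis"
begin

definition diffuse :: "'a measure \<Rightarrow> bool" where
  "diffuse M \<longleftrightarrow> (\<forall>A\<in>sets M. 0 < emeasure M A \<and> emeasure M A < \<infinity> \<longrightarrow>
      (\<exists>B\<in>sets M. B \<subseteq> A \<and> emeasure M B = emeasure M A / 2))"

text \<open>The extended norm \<open>(\<integral>\<bar>f\<bar>^p d\<mu>)^(1/p)\<close>. There is no real power on \<^typ>\<open>ennreal\<close>,
  so the value \<open>\<infinity>\<close> is treated separately. The definition is meant for measurable \<open>f\<close> and
  \<open>0 < p\<close>.\<close>

definition Lp_norm :: "'a measure \<Rightarrow> real \<Rightarrow> ('a \<Rightarrow> real) \<Rightarrow> ennreal" where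
  "Lp_norm M p f =
     (let I = (\<integral>\<^sup>+ x. ennreal (\<bar>f x\<bar> powr p) \<partial>M)
      in if I = \<infinity> then \<infinity> else ennreal (enn2real I powr (1 / p)))"

text \<open>As usual for \<open>\<sigma>\<close>-algebra based integration, function spaces consist of measurable
  functions, not of their classes modulo null sets.\<close>

definition Lp_space :: "'a measure \<Rightarrow> real \<Rightarrow> ('a \<Rightarrow> real) set" where
  "Lp_space M p = {f \<in> borel_measurable M. Lp_norm M p f < \<infinity>}"

definition psi_supp :: "(real \<Rightarrow> ennreal) \<Rightarrow> real set" where
  "psi_supp \<psi> = {p. \<psi> p < \<infinity>}"

text \<open>Endpoints are extended reals so that \<open>b = \<infinity>\<close> is allowed; the one-sided limits are taken in
  \<^typ>\<open>ereal\<close>, as in the library's treatment of interval integrals.\<close>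

definition UPsi :: "ereal \<Rightarrow> ereal \<Rightarrow> (real \<Rightarrow> ennreal) set" where
  "UPsi a b = {\<psi>. (\<forall>p\<in>einterval a b. 0 < \<psi> p \<and> \<psi> p < \<infinity>) \<and>
      continuous_on (einterval a b) \<psi> \<and>
      (((\<psi> \<circ> real_of_ereal) \<longlongrightarrow> \<infinity>) (at_right a) \<or> ((\<psi> \<circ> real_of_ereal) \<longlongrightarrow> \<infinity>) (at_left b))}"

definition G_norm ::
  "'a measure \<Rightarrow> ereal \<Rightarrow> ereal \<Rightarrow> (real \<Rightarrow> ennreal) \<Rightarrow> ('a \<Rightarrow> real) \<Rightarrow> ennreal" where
  "G_norm M a b \<psi> f = (SUP p\<in>einterval a b. Lp_norm M p f / \<psi> p)"

definition G_space ::
  "'a measure \<Rightarrow> ereal \<Rightarrow> ereal \<Rightarrow> (real \<Rightarrow> ennreal) \<Rightarrow> ('a \<Rightarrow> real) set" where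
  "G_space M a b \<psi> = {f \<in> borel_measurable M. G_norm M a b \<psi> f < \<infinity>}"

text \<open>Boundedness of a not necessarily linear operator from \<open>E\<^sub>1\<close> (normed by \<open>N\<^sub>1\<close>) into \<open>E\<^sub>2\<close>
  (normed by \<open>N\<^sub>2\<close>).\<close>

definition bounded_operator ::
  "('f \<Rightarrow> 'g) \<Rightarrow> 'f set \<Rightarrow> ('f \<Rightarrow> ennreal) \<Rightarrow> 'g set \<Rightarrow> ('g \<Rightarrow> ennreal) \<Rightarrow> bool" where
  "bounded_operator Q E\<^sub>1 N\<^sub>1 E\<^sub>2 N\<^sub>2 \<longleftrightarrow>
     Q ` E\<^sub>1 \<subseteq> E\<^sub>2 \<and> (\<exists>C<\<infinity>. \<forall>f\<in>E\<^sub>1. N\<^sub>2 (Q f) \<le> C * N\<^sub>1 f)"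

text \<open>The value \<open>\<infinity>\<close> for \<open>p \<le> 1\<close> makes the support \<open>(1,\<infinity>)\<close>, independently of the values of
  \<^const>\<open>powr\<close> at nonpositive bases.\<close>

definition psi_lg :: "real \<Rightarrow> real \<Rightarrow> (real \<Rightarrow> ennreal) \<Rightarrow> real \<Rightarrow> ennreal" where
  "psi_lg lam \<gamma> \<psi> p =
     (if 1 < p then ennreal (p powr (lam + \<gamma>)) * \<psi> p * ennreal ((p - 1) powr (- \<gamma>)) else \<infinity>)"

end

theory Submission
  imports Defs
begin

text \<open>
  The norm of \<open>G(\<psi>)\<close> is a supremum over the exponents \<open>p\<close>, and the hypothesis on the operator holds
  for each exponent separately, on \<open>G(\<psi>)\<close> itself. The weight \<open>p^(\<lambda>+\<gamma>) (p-1)^(-\<gamma>)\<close> in that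
  hypothesis is exactly the quotient of the new generating function by \<open>\<psi>\<close>. It is positive and
  finite for \<open>1 < p < \<infinity>\<close>, so it cancels when the bound on \<open>|Q f|\<^sub>p\<close> is divided by
  \<open>\<psi>\<^sub>\<lambda>\<^sub>,\<^sub>\<gamma>(p)\<close>, which leaves \<open>C |f|\<^sub>p / \<psi>(p)\<close>. The supremum over \<open>p\<close> preserves this
  inequality (\<open>G_norm_mono_weight\<close>), so the constant of the operator on the scale \<open>L\<^sub>p\<close> also bounds
  its norm on \<open>G(\<psi>)\<close>.
\<close>

lemma ennreal_mult_divide_mult_cancel:
  fixes x y w :: ennreal
  assumes "w \<noteq> 0" "w \<noteq> \<infinity>" "y \<noteq> 0" "y \<noteq> \<infinity>"
  shows "(x * w) / (y * w) = x / y"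
proof -
  have "inverse (y * w) = inverse y * inverse w"
    using assms by (intro ennreal_inverse_mult) (auto simp: less_top)
  moreover have "w * inverse w = 1"
    using assms ennreal_divide_self[of w] by (auto simp: divide_ennreal_def less_top)
  ultimately show ?thesis
    by (simp add: divide_ennreal_def ac_simps)
       (metis mult.assoc mult.commute mult.right_neutral)
qed

text \<open>An exponentwise bound of \<open>g\<close> by \<open>f\<close> with a weight \<open>w\<close> passes to the norms once the generating
  function on the side of \<open>g\<close> absorbs the weight.\<close>

lemma G_norm_mono_weight:
  fixes C :: ennreal
  assumes bound: "\<And>p. p \<in> einterval a b \<Longrightarrow> Lp_norm M p g \<le> C * Lp_norm M p f * w p"
    and weight: "\<And>p. p \<in> einterval a b \<Longrightarrow> 0 < w p \<and> w p < \<infinity>"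
    and psi: "\<And>p. p \<in> einterval a b \<Longrightarrow> 0 < \<psi> p \<and> \<psi> p < \<infinity>"
    and phi: "\<And>p. p \<in> einterval a b \<Longrightarrow> \<phi> p = \<psi> p * w p"
  shows "G_norm M a b \<phi> g \<le> C * G_norm M a b \<psi> f"
  unfolding G_norm_def
proof (rule SUP_least)
  fix p assume p: "p \<in> einterval a b"
  have "Lp_norm M p g / \<phi> p \<le> (C * Lp_norm M p f * w p) / (\<psi> p * w p)"
    unfolding phi[OF p] by (rule divide_right_mono_ennreal[OF bound[OF p]])
  also have "\<dots> = C * (Lp_norm M p f / \<psi> p)"
    using weight[OF p] psi[OF p]
    by (subst ennreal_mult_divide_mult_cancel) (auto simp: ennreal_times_divide)
  also have "\<dots> \<le> C * (SUP p\<in>einterval a b. Lp_norm M p f / \<psi> p)"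
    by (intro mult_left_mono SUP_upper p) simp
  finally show "Lp_norm M p g / \<phi> p \<le> C * (SUP p\<in>einterval a b. Lp_norm M p f / \<psi> p)" .
qed

theorem theorem12:
  fixes M :: "'a measure"
    and \<psi> :: "real \<Rightarrow> ennreal"
    and Q :: "('a \<Rightarrow> real) \<Rightarrow> ('a \<Rightarrow> real)"
    and lam \<gamma> :: real
    and C :: ennreal
  assumes "sigma_finite_measure M"
    and "emeasure M (space M) \<noteq> 0"
    and "diffuse M"
    and "\<psi> \<in> UPsi 1 \<infinity>"
    and "psi_supp \<psi> = {1<..}"
    and "0 \<le> lam" and "0 \<le> \<gamma>" and "C < \<infinity>"
    and "\<And>f. f \<in> (\<Inter>p\<in>{1<..}. Lp_space M p) \<union> G_space M 1 \<infinity> \<psi> \<Longrightarrow> Q f \<in> borel_measurable M"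
    and "\<And>p f. 1 < p \<Longrightarrow> f \<in> (\<Inter>p\<in>{1<..}. Lp_space M p) \<union> G_space M 1 \<infinity> \<psi> \<Longrightarrow>
        Lp_norm M p (Q f) \<le>
          C * Lp_norm M p f * ennreal (p powr (lam + \<gamma>)) * ennreal ((p - 1) powr (- \<gamma>))"
  shows "bounded_operator Q
           (G_space M 1 \<infinity> \<psi>) (G_norm M 1 \<infinity> \<psi>)
           (G_space M 1 \<infinity> (psi_lg lam \<gamma> \<psi>)) (G_norm M 1 \<infinity> (psi_lg lam \<gamma> \<psi>))"
proof -
  have interval: "1 < p" if "p \<in> einterval 1 \<infinity>" for p
    using that by (simp add: einterval_def one_ereal_def)
  define w where "w = (\<lambda>p. ennreal (p powr (lam + \<gamma>)) * ennreal ((p - 1) powr (- \<gamma>)))"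
  have w: "0 < w p \<and> w p < \<infinity>" if "p \<in> einterval 1 \<infinity>" for p
    using interval[OF that] by (auto simp: w_def ennreal_zero_less_mult_iff ennreal_mult_less_top)
  have bound: "G_norm M 1 \<infinity> (psi_lg lam \<gamma> \<psi>) (Q f) \<le> C * G_norm M 1 \<infinity> \<psi> f"
    if f: "f \<in> G_space M 1 \<infinity> \<psi>" for f
  proof (rule G_norm_mono_weight[where w = w])
    fix p :: real assume p: "p \<in> einterval 1 \<infinity>"
    show "Lp_norm M p (Q f) \<le> C * Lp_norm M p f * w p"
      using assms(10)[OF interval[OF p], of f] f by (simp add: w_def mult.assoc)
    show "0 < w p \<and> w p < \<infinity>" by (rule w[OF p])
    show "0 < \<psi> p \<and> \<psi> p < \<infinity>"
      using assms(4) p by (auto simp: UPsi_def)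
    show "psi_lg lam \<gamma> \<psi> p = \<psi> p * w p"
      using interval[OF p] by (simp add: psi_lg_def w_def ac_simps)
  qed
  have "Q f \<in> G_space M 1 \<infinity> (psi_lg lam \<gamma> \<psi>)" if f: "f \<in> G_space M 1 \<infinity> \<psi>" for f
  proof -
    have "C * G_norm M 1 \<infinity> \<psi> f < \<infinity>"
      using f assms(8) by (simp add: G_space_def ennreal_mult_less_top)
    with bound[OF f] have "G_norm M 1 \<infinity> (psi_lg lam \<gamma> \<psi>) (Q f) < \<infinity>"
      by (rule le_less_trans)
    with assms(9)[of f] f show ?thesis
      by (simp add: G_space_def)
  qed
  with bound assms(8) show ?thesis
    unfolding bounded_operator_def by blast
qed

end
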